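(* Every iterated FMQ over a nonempty compact metrizable space $Y$ without isolated points is $k_2$-Hausdorff, not weakly Hausdorff, not KC, and not Hausdorff. (That is, iterated FMQ over a metrizable base produces the same hierarchy level as single-step FMQ, and no amount of iteration over a metrizable base can produce a new level.)
   Context: For a topological space $Z$, $\mathcal{D}_Z$ denotes the collection of dense subsets of $Z$. For nonempty $A\subseteq Z$, let $q\colon Z\to Z/A$ be the projection (of sets) collapsing $A$ to one point $\ast=q(A)$; $\mathrm{FMQ}(Z,A,\mathcal{D}_Z)$ is the set $Z/A$ with the topology of all $U\subseteq Z/A$ such that $q^{-1}(U)$ is open in $Z$ and ($\ast\in U\Rightarrow q^{-1}(U)\in\mathcal{D}_Z$). Iterated FMQ over $Y$: a space $X_r$ ($r\geq1$) obtained by $X_0=Y$ and $X_{j}=\mathrm{FMQ}(X_{j-1},B_j,\mathcal{D}_{X_{j-1}})$ for $1\leq j\leq r$, where each $B_j\subset X_{j-1}$ is finite, nonempty, and contains none of the points produced by collapsing in earlier steps. A space $X$ is KC if every compact subset is closed; weakly Hausdorff if for every compact Hausdorff $K$ and continuous $f\colon K\to X$ the image $f(K)$ is closed; $k_2$-Hausdorff if for every compact Hausdorff $K$ and continuous $f\colon K\to X$ the set $\{(a,b)\in K\times K:f(a)=f(b)\}$ is closed in $K\times K$. *)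

theory Defs
  imports "HOL-Analysis.Analysis"
begin

section \<open>The quotient space FMQ and its iterates\<close>

definition dense_subsets :: "'a topology \<Rightarrow> 'a set set" where
  "dense_subsets Z = {D. D \<subseteq> topspace Z \<and> Z closure_of D = topspace Z}"

text \<open>
  The set \<open>Z/A\<close> is determined only up to the names of its points. A map \<open>q\<close> presents \<open>Z/A\<close>, with
  carrier \<open>q ` topspace Z\<close>, if it collapses \<open>A\<close> to the single point \<open>s\<close> and identifies nothing else.
  Any such presentation is admitted below. Allowing \<open>q\<close> to have the same source and target type
  makes it possible to iterate the construction; no quotient is lost in this way
  (lemma \<open>collapses_exists\<close>).
\<close>

definition collapses :: "'a topology \<Rightarrow> 'a set \<Rightarrow> ('a \<Rightarrow> 'b) \<Rightarrow> 'b \<Rightarrow> bool" where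
  "collapses Z A q s \<longleftrightarrow>
     A \<subseteq> topspace Z \<and> q ` A = {s} \<and>
     inj_on q (topspace Z - A) \<and> s \<notin> q ` (topspace Z - A)"

lemma collapses_exists:
  assumes "A \<subseteq> topspace Z" "a \<in> A"
  shows "collapses Z A (\<lambda>x. if x \<in> A then a else x) a"
  using assms by (auto simp: collapses_def inj_on_def)

text \<open>
  \<open>FMQ Z q s \<D>\<close> is \<open>FMQ(Z, A, \<D>)\<close> for the set \<open>A\<close> that \<open>q\<close> collapses to \<open>s\<close>.
\<close>

definition FMQ :: "'a topology \<Rightarrow> ('a \<Rightarrow> 'b) \<Rightarrow> 'b \<Rightarrow> 'a set set \<Rightarrow> 'b topology" where
  "FMQ Z q s \<D> = topology (\<lambda>U. U \<subseteq> q ` topspace Z \<and>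
      openin Z {x \<in> topspace Z. q x \<in> U} \<and>
      (s \<in> U \<longrightarrow> {x \<in> topspace Z. q x \<in> U} \<in> \<D>))"

lemma dense_subsets_mono:
  assumes "D \<in> dense_subsets Z" "D \<subseteq> E" "E \<subseteq> topspace Z"
  shows "E \<in> dense_subsets Z"
  using assms closure_of_mono[of D E Z] closure_of_subset_topspace[of Z E]
  by (auto simp: dense_subsets_def)

lemma dense_subsets_Int_open:
  assumes "D \<in> dense_subsets Z" "E \<in> dense_subsets Z" "openin Z D"
  shows "D \<inter> E \<in> dense_subsets Z"
  using assms openin_Int_closure_of_subset[of Z D E]
    closure_of_mono[of D "Z closure_of (D \<inter> E)" Z] closure_of_subset_topspace[of Z "D \<inter> E"]
  by (auto simp: dense_subsets_def)

lemma openin_FMQ: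
  "openin (FMQ Z q s (dense_subsets Z)) U \<longleftrightarrow>
     U \<subseteq> q ` topspace Z \<and> openin Z {x \<in> topspace Z. q x \<in> U} \<and>
     (s \<in> U \<longrightarrow> {x \<in> topspace Z. q x \<in> U} \<in> dense_subsets Z)"
proof -
  have Int: "{x \<in> topspace Z. q x \<in> S \<inter> T} =
      {x \<in> topspace Z. q x \<in> S} \<inter> {x \<in> topspace Z. q x \<in> T}" for S T
    by auto
  have Un: "{x \<in> topspace Z. q x \<in> \<Union>\<K>} = (\<Union>K\<in>\<K>. {x \<in> topspace Z. q x \<in> K})" for \<K>
    by auto
  have "istopology (\<lambda>U. U \<subseteq> q ` topspace Z \<and> openin Z {x \<in> topspace Z. q x \<in> U} \<and>
     (s \<in> U \<longrightarrow> {x \<in> topspace Z. q x \<in> U} \<in> dense_subsets Z))" (is "istopology ?P")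
    unfolding istopology_def
  proof (intro conjI allI impI)
    fix S T assume S: "?P S" and T: "?P T"
    show "S \<inter> T \<subseteq> q ` topspace Z" using S by blast
    show "openin Z {x \<in> topspace Z. q x \<in> S \<inter> T}"
      unfolding Int using S T by blast
    show "{x \<in> topspace Z. q x \<in> S \<inter> T} \<in> dense_subsets Z" if "s \<in> S \<inter> T"
      unfolding Int using S T that by (blast intro: dense_subsets_Int_open)
  next
    fix \<K> assume K: "\<forall>K\<in>\<K>. ?P K"
    show "\<Union>\<K> \<subseteq> q ` topspace Z" using K by blast
    show "openin Z {x \<in> topspace Z. q x \<in> \<Union>\<K>}"
      unfolding Un using K by blast
    show "{x \<in> topspace Z. q x \<in> \<Union>\<K>} \<in> dense_subsets Z" if s: "s \<in> \<Union>\<K>"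
    proof -
      obtain K where "K \<in> \<K>" "s \<in> K" using s by blast
      then have "{x \<in> topspace Z. q x \<in> K} \<in> dense_subsets Z" using K by blast
      then show ?thesis using \<open>K \<in> \<K>\<close> by (rule_tac dense_subsets_mono) auto
    qed
  qed
  then show ?thesis by (simp add: FMQ_def)
qed

lemma topspace_FMQ: "topspace (FMQ Z q s (dense_subsets Z)) = q ` topspace Z"
proof (rule subset_antisym)
  show "topspace (FMQ Z q s (dense_subsets Z)) \<subseteq> q ` topspace Z"
    using openin_topspace[of "FMQ Z q s (dense_subsets Z)"] unfolding openin_FMQ by (rule conjunct1)
  have [simp]: "{x \<in> topspace Z. q x \<in> q ` topspace Z} = topspace Z" by auto
  have "topspace Z \<in> dense_subsets Z" by (simp add: dense_subsets_def)
  then have "openin (FMQ Z q s (dense_subsets Z)) (q ` topspace Z)"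
    unfolding openin_FMQ by simp
  then show "q ` topspace Z \<subseteq> topspace (FMQ Z q s (dense_subsets Z))"
    by (rule openin_subset)
qed

text \<open>
  \<open>iterated_FMQ Y r X S\<close>: the space \<open>X\<close> arises from \<open>Y\<close> by \<open>r\<close> steps, and \<open>S\<close> is the set of those
  points of \<open>X\<close> that were produced by collapsing in one of these steps. Earlier collapsed points are
  not in the set \<open>B\<close> collapsed next, so they survive as their images under the projection.
\<close>

inductive iterated_FMQ :: "'a topology \<Rightarrow> nat \<Rightarrow> 'a topology \<Rightarrow> 'a set \<Rightarrow> bool" for Y where
  base: "iterated_FMQ Y 0 Y {}"
| step: "\<lbrakk>iterated_FMQ Y r X S; finite B; B \<noteq> {}; B \<subseteq> topspace X; B \<inter> S = {};
          collapses X B q s\<rbrakk>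
         \<Longrightarrow> iterated_FMQ Y (Suc r) (FMQ X q s (dense_subsets X)) (insert s (q ` S))"

section \<open>Separation properties defined by test maps\<close>

text \<open>
  A definition cannot quantify over all types. For weak Hausdorffness, test spaces \<open>K\<close> on the type
  \<^typ>\<open>'a set set\<close> suffice for a space on \<^typ>\<open>'a\<close>: by lemma \<open>weakly_HausdorffD\<close> the property then
  holds for compact Hausdorff spaces on every type.
\<close>

definition weakly_Hausdorff :: "'a topology \<Rightarrow> bool" where
  "weakly_Hausdorff X \<longleftrightarrow>
     (\<forall>(K :: 'a set set topology) f.
        compact_space K \<and> Hausdorff_space K \<and> continuous_map K X f
        \<longrightarrow> closedin X (f ` topspace K))"

lemma homeomorphic_copy:
  assumes inj: "inj_on e (topspace T)"
  obtains T' where "homeomorphic_map T T' e"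
proof -
  let ?g = "inv_into (topspace T) e"
  let ?T = "pullback_topology (e ` topspace T) ?g T"
  have top: "topspace ?T = e ` topspace T"
    using inj by (auto simp: topspace_pullback_topology)
  have "homeomorphic_maps T ?T e ?g"
    unfolding homeomorphic_maps_def
  proof (intro conjI ballI)
    show "continuous_map ?T T ?g"
      using continuous_map_pullback[of T T id] by simp
    have "continuous_map T T (?g \<circ> e)"
      by (rule continuous_map_eq[of T T id]) (use inj in auto)
    then show "continuous_map T ?T e"
      by (intro continuous_map_pullback') auto
  qed (use inj top in auto)
  then show thesis
    using that by (auto simp: homeomorphic_map_maps)
qed

lemma weakly_HausdorffD:
  fixes X :: "'a topology" and K :: "'k topology"
  assumes X: "weakly_Hausdorff X"
    and K: "compact_space K" "Hausdorff_space K" and f: "continuous_map K X f"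
  shows "closedin X (f ` topspace K)"
proof -
  define D where "D = inv_into (topspace K) f ` f ` topspace K"
  define C where "C = K closure_of D"
  define e where "e p = {f ` (U \<inter> D) | U. openin K U \<and> p \<in> U}" for p
  have DK: "D \<subseteq> topspace K"
    by (auto simp: D_def inv_into_into)
  have injD: "inj_on f D"
    by (auto simp: D_def inj_on_def f_inv_into_f)
  have fD: "f ` D = f ` topspace K"
    unfolding D_def image_image by (auto simp: f_inv_into_f)
  have CK: "C \<subseteq> topspace K" and DC: "D \<subseteq> C"
    using DK by (auto simp: C_def closure_of_subset_topspace closure_of_subset)
  have fC: "f ` C = f ` topspace K"
    using fD CK DC by blast
  have inje: "inj_on e C"
  proof (rule inj_onI, rule ccontr)
    fix p p' assume p: "p \<in> C" "p' \<in> C" "e p = e p'" "p \<noteq> p'"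
    then obtain U U' where U: "openin K U" "openin K U'" "p \<in> U" "p' \<in> U'" "disjnt U U'"
      using K(2) CK unfolding Hausdorff_space_def by (metis subsetD)
    then have "f ` (U \<inter> D) \<in> e p'" using p by (auto simp: e_def)
    then obtain V where V: "openin K V" "p' \<in> V" "f ` (U \<inter> D) = f ` (V \<inter> D)"
      by (auto simp: e_def)
    then have UV: "U \<inter> D = V \<inter> D"
      using injD by (meson Int_lower2 inj_on_image_eq_iff)
    have "openin K (V \<inter> U')" "p' \<in> V \<inter> U'" using U V by auto
    then obtain d where "d \<in> D" "d \<in> V \<inter> U'"
      using p(2) unfolding C_def in_closure_of by blast
    then show False using UV U(5) by (auto simp: disjnt_def)
  qed
  define T where "T = subtopology K C"
  have topT: "topspace T = C" using CK by (auto simp: T_def)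
  have T: "compact_space T" "Hausdorff_space T" "continuous_map T X f"
    using K f unfolding T_def C_def
    by (auto simp: compact_space_subtopology closedin_compact_space Hausdorff_space_subtopology
        continuous_map_from_subtopology)
  obtain T' where T': "homeomorphic_map T T' e"
    using homeomorphic_copy[of e T] inje topT by metis
  then obtain g where g: "homeomorphic_maps T T' e g"
    by (auto simp: homeomorphic_map_maps)
  then have "T homeomorphic_space T'" by (auto simp: homeomorphic_space_def)
  then have "compact_space T'" "Hausdorff_space T'"
    using T homeomorphic_compact_space homeomorphic_Hausdorff_space by blast+
  moreover have "continuous_map T' X (f \<circ> g)"
    using g T(3) continuous_map_compose unfolding homeomorphic_maps_def by blast
  ultimately have "closedin X ((f \<circ> g) ` topspace T')"
    using X unfolding weakly_Hausdorff_def by blast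
  moreover have "g ` topspace T' = C"
    using g homeomorphic_maps_sym homeomorphic_maps_imp_map homeomorphic_imp_surjective_map topT
    by metis
  ultimately show ?thesis using fC unfolding image_comp[symmetric] by simp
qed

text \<open>
  Here the type of the test spaces is a parameter; a space is \<open>k\<^sub>2\<close>-Hausdorff if this holds for
  every type \<^typ>\<open>'k\<close>.
\<close>

definition k2_Hausdorff :: "'k itself \<Rightarrow> 'a topology \<Rightarrow> bool" where
  "k2_Hausdorff TYPE('k) X \<longleftrightarrow>
     (\<forall>(K :: 'k topology) f.
        compact_space K \<and> Hausdorff_space K \<and> continuous_map K X f
        \<longrightarrow> closedin (prod_topology K K)
              {(a, b). a \<in> topspace K \<and> b \<in> topspace K \<and> f a = f b})"

end

(* A set is open in X iff its preimage in Y is open and, in case it contains a collapsed point, dense.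
   Hence the image of a closed set that avoids the collapsed points and has nonempty interior is
   compact but not closed. On the other hand, closed countable subsets of Y are nowhere dense (Baire)
   and have closed images, so a map f from a compact Hausdorff space K into X cannot tell the topology
   of X from the Hausdorff quotient topology: {(k, y). f k = p y} is closed in K x Y, and projecting
   along the compact factor Y shows that {(a, b). f a = f b} is closed. *)

theory Submission
  imports Defs
begin

section \<open>Spaces without isolated points and convergent sequences\<close>

lemma finite_openin_perfect:
  assumes "t1_space Y" "\<forall>y \<in> topspace Y. \<not> openin Y {y}" "openin Y U" "finite U"
  shows "U = {}"
proof (rule ccontr)
  assume "U \<noteq> {}"
  then obtain y where y: "y \<in> U" by blast
  have UY: "U \<subseteq> topspace Y" using assms(3) by (rule openin_subset)
  have "closedin Y (U - {y})"
    using assms(1,4) UY by (auto simp: t1_space_closedin_finite)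
  \<comment> \<open>Finite sets are closed in a T1 space, so taking the other points out of
    \<open>U\<close> would isolate \<open>y\<close>.\<close>
  then have "openin Y (U - (U - {y}))"
    using assms(3) by (rule openin_diff[rotated])
  moreover have "U - (U - {y}) = {y}" using y by blast
  ultimately show False using assms(2) y UY by auto
qed

text \<open>Baire category, applied to the singletons of \<open>C\<close>: they are closed, and have
  empty interior because no point is isolated.\<close>

lemma countable_interior_of_empty:
  assumes "compact_space Y" "Hausdorff_space Y" "\<forall>y \<in> topspace Y. \<not> openin Y {y}"
    and C: "countable C" "C \<subseteq> topspace Y"
  shows "Y interior_of C = {}"
proof -
  have "Y interior_of \<Union>((\<lambda>y. {y}) ` C) = {}"
  proof (rule Baire_category_alt)
    show "completely_metrizable_space Y \<or> locally_compact_space Y \<and> regular_space Y"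
      using assms(1,2) compact_imp_locally_compact_space compact_Hausdorff_imp_regular_space
      by blast
    fix T assume "T \<in> (\<lambda>y. {y}) ` C"
    then obtain y where y: "T = {y}" "y \<in> topspace Y" using C by blast
    have "Y interior_of {y} = {}"
      by (rule finite_openin_perfect[of Y])
        (use assms(2,3) in \<open>auto simp: Hausdorff_imp_t1_space
            intro: finite_subset[OF interior_of_subset]\<close>)
    then show "closedin Y T \<and> Y interior_of T = {}"
      using y assms(2) by (simp add: closedin_Hausdorff_singleton)
  qed (use C in auto)
  then show ?thesis by simp
qed

text \<open>The sets are the balls of radius \<open>1 / (n + 1)\<close> about \<open>y\<close>. Any
  choice of one point from each of them converges to \<open>y\<close>; in this form first
  countability enters \<open>closedin_graph\<close>.\<close>

lemma metrizable_sequence_base: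
  assumes "metrizable_space Y" "y \<in> topspace Y"
  obtains U :: "nat \<Rightarrow> 'a set"
  where "\<And>n. openin Y (U n)" "\<And>n. y \<in> U n"
    "\<And>z. (\<And>n. z n \<in> U n) \<Longrightarrow> limitin Y z y sequentially"
proof -
  obtain M d where "Metric_space M d" and Y: "Y = Metric_space.mtopology M d"
    using assms(1) by (auto simp: metrizable_space_def)
  then interpret Metric_space M d by simp
  have yM: "y \<in> M" using assms(2) Y by simp
  show thesis
  proof (rule that)
    fix n show "openin Y (mball y (inverse (Suc n)))" by (simp add: Y)
    show "y \<in> mball y (inverse (Suc n))" using yM by simp
  next
    fix z assume z: "\<And>n. z n \<in> mball y (inverse (real (Suc n)))"
    have "(\<lambda>n. d (z n) y) \<longlonglongrightarrow> 0"
    proof (rule tendsto_sandwich[OF _ _ tendsto_const LIMSEQ_inverse_real_of_nat])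
      show "\<forall>\<^sub>F n in sequentially. d (z n) y \<le> inverse (real (Suc n))"
        using z by (intro always_eventually allI) (metis commute in_mball less_imp_le)
    qed simp
    then show "limitin Y z y sequentially"
      unfolding Y using yM z
      by (subst limitin_metric_dist_null) (auto intro!: always_eventually)
  qed
qed

text \<open>
  The composite \<open>p\<close> of all projections \<open>Y \<rightarrow> X\<^sub>r\<close> gives a one-step description of an iterated FMQ
  over \<open>Y\<close>: the intermediate density conditions all reduce to density in \<open>Y\<close>.
\<close>

locale collapsed_space =
  fixes Y :: "'a topology" and X :: "'b topology" and p :: "'a \<Rightarrow> 'b" and S :: "'b set"
  assumes compact: "compact_space Y"
    and metrizable: "metrizable_space Y"
    and no_isolated: "\<forall>y \<in> topspace Y. \<not> openin Y {y}"
    and finite_special: "finite {y \<in> topspace Y. p y \<in> S}"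
    and inj: "inj_on p {y \<in> topspace Y. p y \<notin> S}"
    and special: "S \<subseteq> p ` topspace Y"
    and openin_iff: "openin X U \<longleftrightarrow> U \<subseteq> p ` topspace Y \<and> openin Y {y \<in> topspace Y. p y \<in> U} \<and>
      (U \<inter> S \<noteq> {} \<longrightarrow> Y closure_of {y \<in> topspace Y. p y \<in> U} = topspace Y)"
begin

abbreviation pre :: "'b set \<Rightarrow> 'a set" where
  "pre U \<equiv> {y \<in> topspace Y. p y \<in> U}"

section \<open>Open, dense and closed sets under the composite projection\<close>

lemma Hausdorff: "Hausdorff_space Y"
  using metrizable by (rule metrizable_imp_Hausdorff_space)

lemma topspace_X: "topspace X = p ` topspace Y"
proof (rule subset_antisym)
  show "topspace X \<subseteq> p ` topspace Y"
    using openin_topspace[of X] openin_iff by blast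
  have "pre (p ` topspace Y) = topspace Y" by auto
  then have "openin X (p ` topspace Y)" by (simp add: openin_iff)
  then show "p ` topspace Y \<subseteq> topspace X" by (rule openin_subset)
qed

lemma continuous_p: "continuous_map Y X p"
  by (auto simp: continuous_map topspace_X openin_iff)

lemma finite_fibre: "finite (pre {x})"
proof (cases "x \<in> S")
  case True
  then show ?thesis by (intro finite_subset[OF _ finite_special]) auto
next
  case False
  have "finite (p -` {x} \<inter> {y \<in> topspace Y. p y \<notin> S})"
    using inj by (intro finite_vimage_IntI) auto
  then show ?thesis by (rule rev_finite_subset) (use False in auto)
qed

text \<open>Off the special points \<open>p\<close> is injective, so saturating a set can add only
  points over \<open>S\<close>, of which there are finitely many.\<close>

lemma preimage_image_subset:
  assumes "C \<subseteq> topspace Y"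
  shows "pre (p ` C) \<subseteq> C \<union> pre S"
proof
  fix x assume "x \<in> pre (p ` C)"
  then obtain c where c: "x \<in> topspace Y" "c \<in> C" "p x = p c" by blast
  show "x \<in> C \<union> pre S"
  proof (cases "p x \<in> S")
    case False
    then have "x = c" using c assms by (intro inj_onD[OF inj]) auto
    then show ?thesis using c by blast
  qed (use c in blast)
qed

lemma preimage_image:
  assumes "C \<subseteq> topspace Y" "p ` C \<inter> S = {}"
  shows "pre (p ` C) = C"
  using assms preimage_image_subset[OF assms(1)] by (intro subset_antisym subsetI) auto

lemma openin_diff_special:
  assumes "openin Y V"
  shows "openin Y (V - pre S)"
  using assms finite_special Hausdorff
  by (intro openin_diff closedin_Hausdorff_finite) auto

text \<open>A nonempty open \<open>V\<close> in \<open>Y\<close> is infinite, so it survives the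
  removal of the finite set \<open>pre S\<close>. The image of what remains avoids \<open>S\<close>
  and has no density condition to meet, so it is open in \<open>X\<close> and must intersect a dense
  \<open>W\<close>. This equivalence is what lets one collapsing step be stacked on another.\<close>

lemma dense_iff:
  "X closure_of W = topspace X \<longleftrightarrow> Y closure_of (pre W) = topspace Y"
proof
  assume W: "X closure_of W = topspace X"
  show "Y closure_of (pre W) = topspace Y"
    unfolding dense_intersects_open
  proof (intro allI impI)
    fix V assume V: "openin Y V \<and> V \<noteq> {}"
    have "infinite V"
      using V finite_openin_perfect[OF Hausdorff_imp_t1_space[OF Hausdorff] no_isolated] by blast
    then have ne: "V - pre S \<noteq> {}"
      using finite_special by (metis Diff_eq_empty_iff finite_subset)
    have VY: "V \<subseteq> topspace Y" using V openin_subset by blast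
    have disj: "p ` (V - pre S) \<inter> S = {}" using VY by auto
    have "pre (p ` (V - pre S)) = V - pre S"
      by (rule preimage_image) (use VY disj in auto)
    then have "openin X (p ` (V - pre S))"
      unfolding openin_iff[of "p ` (V - pre S)"] using V VY disj openin_diff_special by auto
    then have "W \<inter> p ` (V - pre S) \<noteq> {}"
      using W ne unfolding dense_intersects_open by blast
    then show "pre W \<inter> V \<noteq> {}" using VY by auto
  qed
next
  assume W: "Y closure_of (pre W) = topspace Y"
  show "X closure_of W = topspace X"
    unfolding dense_intersects_open
  proof (intro allI impI)
    fix U assume U: "openin X U \<and> U \<noteq> {}"
    then have "openin Y (pre U)" "pre U \<noteq> {}" by (auto simp: openin_iff)
    then have "pre W \<inter> pre U \<noteq> {}" using W unfolding dense_intersects_open by blast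
    then show "W \<inter> U \<noteq> {}" by auto
  qed
qed

text \<open>Saturation adds finitely many points, so the full preimage of the image is still closed
  and countable. By Baire its complement is dense, hence the complement of the image is open even
  when it contains special points.\<close>

lemma closedin_countable_image:
  assumes C: "closedin Y C" "countable C"
  shows "closedin X (p ` C)"
proof -
  have CY: "C \<subseteq> topspace Y" using C(1) by (rule closedin_subset)
  have eq: "pre (p ` C) = C \<union> (pre S \<inter> pre (p ` C))"
    using CY preimage_image_subset[OF CY] by blast
  have clo: "closedin Y (pre (p ` C))"
    by (subst eq, intro closedin_Un C closedin_Hausdorff_finite)
      (use finite_special Hausdorff in auto)
  have "countable (pre (p ` C))"
    by (subst eq) (use C finite_special in \<open>auto intro: countable_finite\<close>)
  then have "Y interior_of (pre (p ` C)) = {}"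
    using compact Hausdorff no_isolated by (intro countable_interior_of_empty) auto
  then have dense: "Y closure_of (topspace Y - pre (p ` C)) = topspace Y"
    by (simp add: closure_of_complement)
  have "pre (topspace X - p ` C) = topspace Y - pre (p ` C)"
    by (auto simp: topspace_X)
  then have "openin X (topspace X - p ` C)"
    unfolding openin_iff[of "topspace X - p ` C"] using clo dense topspace_X by auto
  moreover have "p ` C \<subseteq> topspace X" unfolding topspace_X using CY by (rule image_mono)
  ultimately show ?thesis by (simp add: closedin_def)
qed

section \<open>Maps from compact Hausdorff spaces and their coincidence sets\<close>

text \<open>
  A sequence in \<open>Y\<close> witnessing that the set is not closed would, together with its limit, form a
  countable closed set, whose image in \<open>X\<close> is closed.
\<close>

lemma closedin_graph:
  fixes K :: "'k topology"
  assumes K: "compact_space K" "Hausdorff_space K" and f: "continuous_map K X f"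
  shows "closedin (prod_topology K Y) {(k, y). k \<in> topspace K \<and> y \<in> topspace Y \<and> f k = p y}"
    (is "closedin _ ?G")
proof -
  have separated: "\<exists>V U. openin K V \<and> openin Y U \<and> k \<in> V \<and> y \<in> U \<and> (\<forall>a\<in>V. \<forall>b\<in>U. f a \<noteq> p b)"
    if k: "k \<in> topspace K" and y: "y \<in> topspace Y" and ne: "f k \<noteq> p y" for k y
  proof -
    have "closedin X (p ` {y})"
      using y Hausdorff by (intro closedin_countable_image closedin_Hausdorff_singleton) auto
    then have "closedin K {a \<in> topspace K. f a \<in> {p y}}"
      using f closedin_continuous_map_preimage by fastforce
    \<comment> \<open>Regularity of \<open>K\<close> separates \<open>k\<close> from the fibre of
      \<open>f\<close> over \<open>p y\<close>. It remains to shrink the neighbourhood of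
      \<open>y\<close> until its image misses all values of \<open>f\<close> on the closed
      complement of \<open>N\<close>, which contains \<open>V\<close>.\<close>
    then obtain V N where VN: "openin K V" "openin K N" "k \<in> V"
      "{a \<in> topspace K. f a \<in> {p y}} \<subseteq> N" "disjnt V N"
      using compact_Hausdorff_imp_regular_space[OF K] k ne
      unfolding regular_space_def by (metis (lifting) DiffI mem_Collect_eq singletonD)
    obtain U where U: "\<And>n. openin Y (U n)" "\<And>n. y \<in> U n"
      and lim: "\<And>z. (\<And>n. z n \<in> U n) \<Longrightarrow> limitin Y z y sequentially"
      using metrizable_sequence_base[OF metrizable y] by metis
    have "\<exists>n. \<forall>a\<in>topspace K - N. \<forall>b\<in>U n. f a \<noteq> p b"
    proof (rule ccontr)
      assume "\<not> ?thesis"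
      then have "\<forall>n. \<exists>a b. a \<in> topspace K - N \<and> b \<in> U n \<and> f a = p b" by blast
      then obtain x z where x: "\<And>n. x n \<in> topspace K - N" and z: "\<And>n. z n \<in> U n"
        and xz: "\<And>n. f (x n) = p (z n)" by metis
      have zY: "z n \<in> topspace Y" for n using z U(1) openin_subset by blast
      \<comment> \<open>Tails of the sequence, taken with the limit, are closed and countable. Hence
        the \<open>D n\<close> are nonempty, nested and closed in the compact space
        \<open>K\<close>, and have a common point \<open>c\<close>.\<close>
      define C where "C n = insert y (z ` {n..})" for n
      define D where "D n = {a \<in> topspace K - N. f a \<in> p ` C n}" for n
      have "closedin Y (C n)" for n
        unfolding C_def
        by (rule compactin_imp_closedin[OF Hausdorff compactin_sequence_with_limit])
          (use lim[OF z] zY in auto)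
      then have "closedin X (p ` C n)" for n
        by (rule closedin_countable_image) (simp add: C_def)
      then have "closedin K {a \<in> topspace K. f a \<in> p ` C n}" for n
        using f closedin_continuous_map_preimage by blast
      moreover have "D n = (topspace K - N) \<inter> {a \<in> topspace K. f a \<in> p ` C n}" for n
        by (auto simp: D_def)
      ultimately have "closedin K (D n)" for n
        using VN(2) by (auto intro: closedin_diff)
      moreover have "x n \<in> D n" for n
        using x xz by (auto simp: D_def C_def)
      then have "D n \<noteq> {}" for n by blast
      moreover have "decseq D"
        by (fastforce simp: decseq_def D_def C_def)
      ultimately have "(\<Inter>n. D n) \<noteq> {}"
        by (intro compact_space_imp_nest[OF K(1)])
      then obtain c where c: "\<And>n. c \<in> D n" by blast
      have "f c \<noteq> p y" using c[of 0] VN(4) by (auto simp: D_def)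
      \<comment> \<open>The finite fibre over \<open>f c\<close> is closed and omits
        \<open>y\<close>, so \<open>z\<close> eventually avoids it. Yet \<open>c\<close> lies in
        every \<open>D m\<close>, so \<open>f c\<close> is \<open>p (z n)\<close> for some
        \<open>n\<close> \<ge> \<open>m\<close>.\<close>
      then have "openin Y (topspace Y - pre {f c})" "y \<in> topspace Y - pre {f c}"
        using y finite_fibre[of "f c"] Hausdorff by (auto intro!: openin_diff closedin_Hausdorff_finite)
      then have "\<forall>\<^sub>F n in sequentially. z n \<in> topspace Y - pre {f c}"
        using lim[OF z] unfolding limitin_def by blast
      then obtain m where "\<And>n. n \<ge> m \<Longrightarrow> p (z n) \<noteq> f c"
        unfolding eventually_sequentially by force
      then show False
        using c[of m] \<open>f c \<noteq> p y\<close> by (fastforce simp: D_def C_def)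
    qed
    then obtain n where n: "\<forall>a\<in>topspace K - N. \<forall>b\<in>U n. f a \<noteq> p b" by blast
    have "V \<subseteq> topspace K - N"
      using VN(1,5) openin_subset by (fastforce simp: disjnt_def)
    then have "\<forall>a\<in>V. \<forall>b\<in>U n. f a \<noteq> p b" using n by blast
    then show ?thesis using VN(1,3) U(1)[of n] U(2)[of n] by (intro exI conjI)
  qed
  have "openin (prod_topology K Y) (topspace (prod_topology K Y) - ?G)"
    unfolding openin_prod_topology_alt
  proof (intro allI impI)
    fix k y assume "(k, y) \<in> topspace (prod_topology K Y) - ?G"
    then have "k \<in> topspace K" "y \<in> topspace Y" "f k \<noteq> p y" by auto
    then obtain V U where VU: "openin K V" "openin Y U" "k \<in> V" "y \<in> U"
      and "\<forall>a\<in>V. \<forall>b\<in>U. f a \<noteq> p b"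
      using separated[of k y] by blast
    then have "V \<times> U \<subseteq> topspace (prod_topology K Y) - ?G"
      using openin_subset[OF VU(1)] openin_subset[OF VU(2)] by auto
    then show "\<exists>V U. openin K V \<and> openin Y U \<and> k \<in> V \<and> y \<in> U \<and>
        V \<times> U \<subseteq> topspace (prod_topology K Y) - ?G"
      using VU by blast
  qed
  then show ?thesis
    by (auto simp: closedin_def)
qed

text \<open>As \<open>p\<close> is onto \<open>X\<close>, two values \<open>f a\<close> and
  \<open>f b\<close> agree iff both equal \<open>p y\<close> for some \<open>y\<close>. So the
  coincidence set is the projection of \<open>?E\<close>, an intersection of two pullbacks of the
  closed graph, and projecting along the compact \<open>Y\<close> is a closed map.\<close>

lemma k2_Hausdorff: "k2_Hausdorff TYPE('k) X"
  unfolding k2_Hausdorff_def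
proof (intro allI impI, elim conjE)
  fix K :: "'k topology" and f
  assume K: "compact_space K" "Hausdorff_space K" and f: "continuous_map K X f"
  let ?G = "{(k, y). k \<in> topspace K \<and> y \<in> topspace Y \<and> f k = p y}"
  let ?T = "prod_topology (prod_topology K K) Y"
  let ?E = "{w \<in> topspace ?T. (fst (fst w), snd w) \<in> ?G} \<inter> {w \<in> topspace ?T. (snd (fst w), snd w) \<in> ?G}"
  have "continuous_map ?T (prod_topology K Y) (\<lambda>w. (fst (fst w), snd w))"
    "continuous_map ?T (prod_topology K Y) (\<lambda>w. (snd (fst w), snd w))"
    using continuous_map_compose[OF continuous_map_fst continuous_map_fst]
      continuous_map_compose[OF continuous_map_fst continuous_map_snd]
    by (auto simp: o_def intro!: continuous_map_pairedI continuous_map_snd)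
  then have "closedin ?T ?E"
    by (intro closedin_Int closedin_continuous_map_preimage[OF _ closedin_graph[OF K f]])
  then have "closedin (prod_topology K K) (fst ` ?E)"
    using closed_map_fst[OF compact] unfolding closed_map_def by blast
  moreover have "fst ` ?E = {(a, b). a \<in> topspace K \<and> b \<in> topspace K \<and> f a = f b}"
  proof (intro equalityI subsetI)
    fix w assume "w \<in> {(a, b). a \<in> topspace K \<and> b \<in> topspace K \<and> f a = f b}"
    then obtain a b where ab: "w = (a, b)" "a \<in> topspace K" "b \<in> topspace K" "f a = f b"
      by blast
    then have "f a \<in> p ` topspace Y"
      using f unfolding continuous_map_def topspace_X by blast
    then obtain y where "y \<in> topspace Y" "f a = p y" by blast
    then have "((a, b), y) \<in> ?E" using ab by simp
    then show "w \<in> fst ` ?E" using ab(1) by force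
  qed auto
  ultimately show "closedin (prod_topology K K)
      {(a, b). a \<in> topspace K \<and> b \<in> topspace K \<and> f a = f b}" by simp
qed

section \<open>Failure of weak Hausdorffness and of KC\<close>

text \<open>Removing an open neighbourhood \<open>W\<close> of \<open>pre S\<close> leaves a closed
  \<open>C\<close> that, for suitable \<open>W\<close>, contains a nonempty open \<open>V\<close>.
  The complement of the image of \<open>C\<close> then contains a special point, but its preimage
  misses \<open>V\<close> and is not dense.\<close>

lemma not_closed_compact_image:
  assumes "S \<noteq> {}"
  obtains C where "closedin Y C" "\<not> closedin X (p ` C)"
proof -
  obtain s where s: "s \<in> S" using assms by blast
  have "infinite (topspace Y)"
    using s special finite_openin_perfect[OF Hausdorff_imp_t1_space[OF Hausdorff] no_isolated openin_topspace]
    by blast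
  then obtain y where y: "y \<in> topspace Y - pre S"
    using finite_special by (metis Diff_eq_empty_iff ex_in_conv finite_subset)
  have "closedin Y (pre S)"
    using Hausdorff finite_special by (intro closedin_Hausdorff_finite) auto
  then obtain V W where VW: "openin Y V" "openin Y W" "y \<in> V" "pre S \<subseteq> W" "disjnt V W"
    using y metrizable_imp_regular_space[OF metrizable, unfolded regular_space_def,
        THEN spec, THEN spec, of "pre S" y] by blast
  define C where "C = topspace Y - W"
  have VC: "openin Y V" "closedin Y C" "y \<in> V" "V \<subseteq> C" "C \<subseteq> topspace Y - pre S"
    using VW openin_subset[OF VW(1)] by (auto simp: C_def disjnt_def)
  have "\<not> closedin X (p ` C)"
  proof
    assume "closedin X (p ` C)"
    have disj: "pre (topspace X - p ` C) \<inter> V = {}" using VC(4) by auto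
    from \<open>closedin X (p ` C)\<close> have "openin X (topspace X - p ` C)" by (simp add: closedin_def)
    moreover have "s \<in> topspace X - p ` C"
      unfolding topspace_X using s special VC(5) by blast
    ultimately have "Y closure_of pre (topspace X - p ` C) = topspace Y"
      using s openin_iff[of "topspace X - p ` C"] by blast
    then have "pre (topspace X - p ` C) \<inter> V \<noteq> {}"
      using VC(1,3) unfolding dense_intersects_open by blast
    then show False using disj by blast
  qed
  then show thesis using that VC(2) by blast
qed

lemma not_weakly_Hausdorff:
  assumes "S \<noteq> {}"
  shows "\<not> weakly_Hausdorff X"
proof
  assume wH: "weakly_Hausdorff X"
  obtain C where C: "closedin Y C" "\<not> closedin X (p ` C)"
    using not_closed_compact_image[OF assms] by blast
  \<comment> \<open>The test map is \<open>p\<close> on the compact Hausdorff subspace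
    \<open>C\<close>. Its points have the type of \<open>Y\<close>, which is why
    \<open>weakly_HausdorffD\<close> is used in place of the definition.\<close>
  have "closedin X (p ` topspace (subtopology Y C))"
    using C compact Hausdorff continuous_p
    by (intro weakly_HausdorffD[OF wH] compact_space_subtopology Hausdorff_space_subtopology
        continuous_map_from_subtopology closedin_compact_space)
  then show False using C closedin_subset[of Y C] by (simp add: Int_absorb1)
qed

lemma not_kc_space:
  assumes "S \<noteq> {}"
  shows "\<not> kc_space X"
proof -
  obtain C where C: "closedin Y C" "\<not> closedin X (p ` C)"
    using not_closed_compact_image[OF assms] by blast
  have "compactin X (p ` C)"
    using closedin_compact_space[OF compact C(1)] continuous_p by (rule image_compactin)
  then show ?thesis using C by (auto simp: kc_space_def)
qed

text \<open>The inductive step. As \<open>B\<close> misses \<open>S\<close>, the old special points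
  stay distinct from each other and from \<open>s\<close>; only the finite set \<open>pre B\<close>
  joins the preimage of the special points.\<close>

lemma collapsed_space_FMQ:
  assumes B: "finite B" "B \<inter> S = {}" and q: "collapses X B q s"
  shows "collapsed_space Y (FMQ X q s (dense_subsets X)) (q \<circ> p) (insert s (q ` S))"
proof
  have BX: "B \<subseteq> topspace X" and qB: "q ` B = {s}" and qinj: "inj_on q (topspace X - B)"
    and sq: "s \<notin> q ` (topspace X - B)"
    using q by (auto simp: collapses_def)
  have SX: "S \<subseteq> topspace X - B" using special B(2) by (auto simp: topspace_X)
  have q_s: "q x = s \<longleftrightarrow> x \<in> B" if "x \<in> topspace X" for x
    using that qB sq by blast
  have q_S: "q x \<in> q ` S \<longleftrightarrow> x \<in> S" if "x \<in> topspace X" for x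
  proof
    assume "q x \<in> q ` S"
    then obtain t where t: "t \<in> S" "q x = q t" by blast
    have t': "t \<in> topspace X - B" using t(1) SX by blast
    then have "q x \<noteq> s" using t(2) q_s by simp
    then have "x \<in> topspace X - B" using q_s that by simp
    then have "x = t" using t(2) t' by (intro inj_onD[OF qinj])
    then show "x \<in> S" using t(1) by simp
  qed blast
  have special': "{y \<in> topspace Y. (q \<circ> p) y \<in> insert s (q ` S)} = pre S \<union> pre B"
    using q_s q_S by (auto simp: topspace_X)
  have "pre B = (\<Union>x\<in>B. pre {x})" by auto
  then have "finite (pre B)" using B(1) finite_fibre by simp
  then show "finite {y \<in> topspace Y. (q \<circ> p) y \<in> insert s (q ` S)}"
    unfolding special' using finite_special by blast
  show "inj_on (q \<circ> p) {y \<in> topspace Y. (q \<circ> p) y \<notin> insert s (q ` S)}"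
  proof (rule comp_inj_on)
    show "inj_on p {y \<in> topspace Y. (q \<circ> p) y \<notin> insert s (q ` S)}"
      by (rule inj_on_subset[OF inj]) auto
    show "inj_on q (p ` {y \<in> topspace Y. (q \<circ> p) y \<notin> insert s (q ` S)})"
      by (rule inj_on_subset[OF qinj]) (use qB in \<open>auto simp: topspace_X\<close>)
  qed
  show "insert s (q ` S) \<subseteq> (q \<circ> p) ` topspace Y"
    unfolding image_comp[symmetric] topspace_X[symmetric] using qB BX SX by blast
  fix U
  let ?W = "{x \<in> topspace X. q x \<in> U}"
  have W: "pre ?W = {y \<in> topspace Y. (q \<circ> p) y \<in> U}" by (auto simp: topspace_X)
  have WS: "?W \<inter> S \<noteq> {} \<longleftrightarrow> U \<inter> q ` S \<noteq> {}" using SX by blast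
  have dense: "?W \<in> dense_subsets X \<longleftrightarrow> Y closure_of (pre ?W) = topspace Y"
    by (simp add: dense_subsets_def dense_iff)
  have "?W \<subseteq> p ` topspace Y" by (auto simp: topspace_X)
  \<comment> \<open>Openness in \<open>X\<close> carries the density condition for the old special
    points, and the new topology adds it for \<open>s\<close>. By \<open>dense_iff\<close> both ask
    for density of the same set in \<open>Y\<close>, so they merge into one condition.\<close>
  then have open_W: "openin X ?W \<longleftrightarrow> openin Y (pre ?W) \<and>
      (U \<inter> q ` S \<noteq> {} \<longrightarrow> Y closure_of (pre ?W) = topspace Y)"
    unfolding openin_iff[of ?W] WS by simp
  have US: "U \<inter> insert s (q ` S) \<noteq> {} \<longleftrightarrow> s \<in> U \<or> U \<inter> q ` S \<noteq> {}" by blast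
  have im: "(q \<circ> p) ` topspace Y = q ` topspace X" by (simp add: topspace_X image_comp)
  show "openin (FMQ X q s (dense_subsets X)) U \<longleftrightarrow> U \<subseteq> (q \<circ> p) ` topspace Y \<and>
      openin Y {y \<in> topspace Y. (q \<circ> p) y \<in> U} \<and> (U \<inter> insert s (q ` S) \<noteq> {} \<longrightarrow>
        Y closure_of {y \<in> topspace Y. (q \<circ> p) y \<in> U} = topspace Y)"
    unfolding openin_FMQ open_W dense W US im by argo
qed (fact compact metrizable no_isolated)+

end

text \<open>Induction along the steps, starting from \<open>id\<close> with no special points, where
  the density condition is vacuous, and composing with each new projection.\<close>

lemma iterated_FMQ_collapsed_space:
  assumes "iterated_FMQ Y r X S"
    and Y: "compact_space Y" "metrizable_space Y" "\<forall>y \<in> topspace Y. \<not> openin Y {y}"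
  shows "\<exists>p. collapsed_space Y X p S"
  using assms(1)
proof induction
  case base
  have "{y \<in> topspace Y. y \<in> U} = U" if "U \<subseteq> topspace Y" for U using that by blast
  then have open_id: "openin Y U \<longleftrightarrow> U \<subseteq> topspace Y \<and> openin Y {y \<in> topspace Y. y \<in> U}" for U
    using openin_subset[of Y U] by metis
  have "collapsed_space Y Y id {}"
  proof
    show "openin Y U \<longleftrightarrow> U \<subseteq> id ` topspace Y \<and> openin Y {y \<in> topspace Y. id y \<in> U} \<and>
        (U \<inter> {} \<noteq> {} \<longrightarrow> Y closure_of {y \<in> topspace Y. id y \<in> U} = topspace Y)" for U
      using open_id[of U] unfolding id_apply image_id Int_empty_right by blast
  qed (use Y in auto)
  then show ?case by blast
next
  case (step r X S B q s)
  then show ?case using collapsed_space.collapsed_space_FMQ by metis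
qed

lemma iterated_FMQ_special_nonempty:
  assumes "iterated_FMQ Y r X S" "r \<ge> 1"
  shows "S \<noteq> {}"
  using assms by cases auto

theorem corollary7p11:
  fixes Y X :: "'a topology" and S :: "'a set" and r :: nat
  assumes "topspace Y \<noteq> {}" and "compact_space Y" and "metrizable_space Y"
    and "\<forall>y \<in> topspace Y. \<not> openin Y {y}"
    and "r \<ge> 1" and "iterated_FMQ Y r X S"
  shows "k2_Hausdorff TYPE('k) X \<and> \<not> weakly_Hausdorff X \<and> \<not> kc_space X \<and> \<not> Hausdorff_space X"
proof -
  obtain p where "collapsed_space Y X p S"
    using iterated_FMQ_collapsed_space assms by metis
  then interpret collapsed_space Y X p S .
  have "S \<noteq> {}" using iterated_FMQ_special_nonempty assms by metis
  then show ?thesis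
    using k2_Hausdorff not_weakly_Hausdorff not_kc_space Hausdorff_imp_kc_space by blast
qed

end
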